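(* The closure of the class $\mathcal{E}$ in $\mathcal{O}(\mathbb{C})$ is equal to $\mathcal{O}^*(\mathbb{C})\cup\{0\}$.
   Context: $\mathcal{O}(\mathbb{C})$ is the space of all entire functions, equipped with the compact-open topology (uniform convergence on compact sets). $\mathcal{O}^*(\mathbb{C})$ denotes the set of all non-vanishing entire functions (no zeros in $\mathbb{C}$), and $0$ denotes the identically zero function. The class $\mathcal{E}$ consists of all entire functions $F_0$ for which there exist a sequence of entire functions $(F_n)_{n\ge1}$ and a sequence of complex numbers $(\lambda_n)_{n\geq1}$ satisfying $F_n(z)=\lambda_{n+1}e^{F_{n+1}(z)}$ for all $z\in\mathbb{C}$ and all $n\geq 0$. *)

theory Defs
  imports "HOL-Complex_Analysis.Complex_Analysis"
begin

definition entire :: "(complex \<Rightarrow> complex) set" where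
  "entire = {f. f holomorphic_on UNIV}"

definition nonvanishing_entire :: "(complex \<Rightarrow> complex) set" where
  "nonvanishing_entire = {f \<in> entire. \<forall>z. f z \<noteq> 0}"

definition compact_open_entire :: "(complex \<Rightarrow> complex) topology" where
  "compact_open_entire =
     topology_generated_by {{f \<in> entire. f ` K \<subseteq> U} | K U. compact K \<and> open U}"

text \<open>The sequence \<open>c\<close> plays the role of \<open>\<lambda>\<^sub>1, \<lambda>\<^sub>2, \<dots>\<close>; the value \<open>c 0\<close> is never used.\<close>

definition class_E :: "(complex \<Rightarrow> complex) set" where
  "class_E = {f \<in> entire. \<exists>(F :: nat \<Rightarrow> complex \<Rightarrow> complex) (c :: nat \<Rightarrow> complex).
     F 0 = f \<and> (\<forall>n\<ge>1. F n \<in> entire) \<and>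
     (\<forall>n z. F n z = c (Suc n) * exp (F (Suc n) z))}"

lemma topspace_compact_open_entire [simp]: "topspace compact_open_entire = entire"
proof -
  have "entire \<in> {{f \<in> entire. f ` K \<subseteq> U} | K U. compact K \<and> open U}"
    by (rule CollectI, rule exI[of _ "{}"], rule exI[of _ UNIV]) auto
  then show ?thesis
    unfolding compact_open_entire_def topology_generated_by_topspace by blast
qed

text \<open>The compact-open topology is the topology of uniform convergence on compact sets.\<close>

lemma openin_compact_open_entire_iff:
  "openin compact_open_entire T \<longleftrightarrow> T \<subseteq> entire \<and>
     (\<forall>f\<in>T. \<exists>K e. compact K \<and> e > 0 \<and> {g \<in> entire. \<forall>z\<in>K. dist (g z) (f z) < e} \<subseteq> T)"
    (is "?L \<longleftrightarrow> ?R")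
proof
  assume ?L
  then have "T \<subseteq> entire" using openin_subset by fastforce
  moreover have "\<exists>K e. compact K \<and> e > 0 \<and> {g \<in> entire. \<forall>z\<in>K. dist (g z) (f z) < e} \<subseteq> T"
    if "f \<in> T" for f
    using openin_topology_generated_by[OF \<open>?L\<close>[unfolded compact_open_entire_def]] that
  proof (induction arbitrary: f rule: generate_topology_on.induct)
    case Empty
    then show ?case by auto
  next
    case (Int a b)
    then obtain K e K' e' where *: "compact K" "e > 0" "{g \<in> entire. \<forall>z\<in>K. dist (g z) (f z) < e} \<subseteq> a"
      "compact K'" "e' > 0" "{g \<in> entire. \<forall>z\<in>K'. dist (g z) (f z) < e'} \<subseteq> b"
      by (meson IntD1 IntD2)
    show ?case
      using * by (intro exI[of _ "K \<union> K'"] exI[of _ "min e e'"]) (auto simp: compact_Un)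
  next
    case (UN A)
    then obtain a where a: "a \<in> A" "f \<in> a" by auto
    then obtain K e where "compact K" "e > 0" "{g \<in> entire. \<forall>z\<in>K. dist (g z) (f z) < e} \<subseteq> a"
      using UN by meson
    moreover from a have "a \<subseteq> \<Union>A" by blast
    ultimately show ?case by (intro exI[of _ K] exI[of _ e] conjI) auto
  next
    case (Basis s)
    then obtain K U where KU: "s = {f \<in> entire. f ` K \<subseteq> U}" "compact K" "open U" by auto
    have "f holomorphic_on UNIV" using Basis KU by (auto simp: entire_def)
    then have "continuous_on K f"
      using continuous_on_subset[OF holomorphic_on_imp_continuous_on[of f UNIV]] by auto
    then have "compact (f ` K)"
      using KU(2) compact_continuous_image by blast
    moreover have "f ` K \<subseteq> U" using Basis KU by auto
    ultimately obtain e where e: "e > 0" "(\<Union>x\<in>f ` K. ball x e) \<subseteq> U"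
      using compact_subset_open_imp_ball_epsilon_subset[OF _ KU(3)] by blast
    have "{g \<in> entire. \<forall>z\<in>K. dist (g z) (f z) < e} \<subseteq> s"
      using e by (auto simp: KU(1) subset_iff dist_commute Bex_def)
    with e(1) KU(2) show ?case by (intro exI[of _ K] exI[of _ e] conjI)
  qed
  ultimately show ?R by blast
next
  assume R: ?R
  show ?L
  proof (subst openin_subopen, intro ballI)
    fix f assume "f \<in> T"
    then obtain K e where K: "compact K" "e > 0" 
      "{g \<in> entire. \<forall>z\<in>K. dist (g z) (f z) < e} \<subseteq> T" using R by blast
    have f: "f \<in> entire" using R \<open>f \<in> T\<close> by blast
    have cont: "continuous_on K f"
      using f continuous_on_subset[OF holomorphic_on_imp_continuous_on[of f UNIV]]
      by (auto simp: entire_def)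
    then have "uniformly_continuous_on K f" using K compact_uniformly_continuous by blast
    then obtain d where d: "d > 0"
      "\<And>x y. \<lbrakk>x \<in> K; y \<in> K; dist y x < d\<rbrakk> \<Longrightarrow> dist (f y) (f x) < e/2"
      unfolding uniformly_continuous_on_def using half_gt_zero[OF K(2)] by blast
    have "K \<subseteq> (\<Union>x\<in>K. ball x (d/2))" using d by auto
    then obtain X where X: "X \<subseteq> K" "finite X" "K \<subseteq> (\<Union>x\<in>X. ball x (d/2))"
      using compactE_image[OF K(1), of K "\<lambda>x. ball x (d/2)"] by auto
    define V where "V x = {g \<in> entire. g ` (K \<inter> cball x (d/2)) \<subseteq> ball (f x) (e/2)}" for x
    have "openin compact_open_entire (V x)" for x
      unfolding V_def compact_open_entire_def
      by (rule topology_generated_by_Basis) (use K in blast)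
    then have op: "openin compact_open_entire (entire \<inter> (\<Inter>x\<in>X. V x))"
      using X(2) by (cases "X = {}")
        (auto intro!: openin_Int openin_Inter simp flip: topspace_compact_open_entire)
    have fx: "dist (f x) (f z) * 2 < e" if "x \<in> X" "z \<in> K" "dist x z * 2 \<le> d" for x z
    proof -
      have "dist x z < d" using that(3) d(1) by linarith
      then have "dist (f x) (f z) < e/2" using d(2)[of z x] that X by auto
      then show ?thesis by linarith
    qed
    have "f \<in> entire \<inter> (\<Inter>x\<in>X. V x)"
      using f fx by (auto simp: V_def)
    moreover have "g \<in> T" if g: "g \<in> entire \<inter> (\<Inter>x\<in>X. V x)" for g
    proof -
      have "dist (g z) (f z) < e" if zK: "z \<in> K" for z
      proof -
        obtain x where x: "x \<in> X" "z \<in> ball x (d/2)" using X(3) zK by blast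
        have "g z \<in> ball (f x) (e/2)"
          using g x that unfolding V_def by fastforce
        moreover have "dist (f x) (f z) * 2 < e" using fx[of x z] x that by auto
        ultimately show ?thesis
          using dist_triangle[of "g z" "f z" "f x"] by (auto simp: dist_commute)
      qed
      then show ?thesis using K g by auto
    qed
    ultimately show "\<exists>W. openin compact_open_entire W \<and> f \<in> W \<and> W \<subseteq> T"
      using op by blast
  qed
qed

end

theory Submission
  imports Defs
begin

text \<open>
  The heart of the matter is a single entire function. The map \<open>E w = 2 * (exp w - 1)\<close> has a
  repelling fixed point at \<open>0\<close> with multiplier \<open>2\<close>, so it has a Poincare function \<open>L\<close>: an entire
  solution of \<open>L (2 * z) = E (L z)\<close> with \<open>L z = z + O(z\<^sup>2)\<close> at \<open>0\<close>
  (\<open>entire_poincare\<close>, \<open>poincare_functional_equation\<close>, \<open>poincare_near_0\<close>).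
  Rewritten as \<open>2 + L z = 2 * exp (-2) * exp (2 + L (z / 2))\<close>, the functional equation exhibits
  \<open>2 + L z\<close> as a tower of exponentials that can be continued forever by halving the argument.
  The argument may be any entire function \<open>h z\<close>, hence \<open>2 + L (h z)\<close> belongs to the class
  (\<open>two_plus_poincare_in_class_E\<close>).

  The class is closed under multiplication by constants and under \<open>exp\<close>. Applying both to
  \<open>2 + L (\<epsilon> * g z)\<close> shows that \<open>exp (L (\<epsilon> * g z) / \<epsilon>)\<close> belongs to the class for every entire \<open>g\<close>.
  As \<open>\<epsilon>\<close> tends to \<open>0\<close>, the expansion of \<open>L\<close> at \<open>0\<close> gives \<open>L (\<epsilon> * g z) / \<epsilon> \<longlonglongrightarrow> g z\<close> uniformly on compact
  sets, so \<open>exp (g z)\<close> lies in the closure (\<open>exp_approximable_by_class_E\<close>). Every non-vanishing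
  entire function has the form \<open>exp (g z)\<close>, because the plane is simply connected.

  Conversely, a member \<open>c 1 * exp (F 1 z)\<close> of the class either has no zeros or, when \<open>c 1 = 0\<close>, is
  identically \<open>0\<close>, and by Hurwitz's theorem this alternative survives locally uniform limits
  (\<open>closure_of_nonvanishing_or_zero\<close>).
\<close>

section \<open>A Poincare function\<close>

text \<open>
  With \<open>E w = 2 * (exp w - 1)\<close> this is \<open>(E ^^ n) (z / 2 ^ n)\<close>; putting the halving inside the
  recursion makes the functional equation of the limit immediate.
\<close>

fun poincare_approx :: "nat \<Rightarrow> complex \<Rightarrow> complex" where
  "poincare_approx 0 z = z"
| "poincare_approx (Suc n) z = 2 * (exp (poincare_approx n (z / 2)) - 1)"

lemma exp_le_inverse_one_minus:
  fixes u :: real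
  assumes "u < 1"
  shows "exp u \<le> 1 / (1 - u)"
proof -
  have "1 - u \<le> exp (- u)" using exp_ge_add_one_self[of "-u"] by simp
  then show ?thesis using assms by (simp add: exp_minus field_simps)
qed

lemma norm_exp_diff_le:
  fixes a b :: complex
  assumes "norm a \<le> B" "norm b \<le> B"
  shows "norm (exp a - exp b) \<le> exp B * norm (a - b)"
proof (rule field_differentiable_bound[of "cball 0 B" exp exp])
  fix z :: complex assume "z \<in> cball 0 B"
  then show "norm (exp z) \<le> exp B"
    using norm_exp[of z] by (meson exp_le_cancel_iff mem_cball_0 order_trans)
qed (use assms in \<open>auto intro!: derivative_eq_intros\<close>)

text \<open>
  The bound \<open>u x = x / (1 - x)\<close> is chosen because \<open>2 * (exp (u (x / 2)) - 1) \<le> u x\<close>, so that it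
  reproduces itself under the recursion. This is what keeps the iterates bounded near \<open>0\<close>
  uniformly in \<open>n\<close>.
\<close>

lemma norm_poincare_approx_le:
  assumes "norm z < 1"
  shows "norm (poincare_approx n z) \<le> norm z / (1 - norm z)"
  using assms
proof (induction n arbitrary: z)
  case 0
  have "norm z * (1 - norm z) \<le> norm z * 1" by (intro mult_left_mono) auto
  with 0 show ?case by (simp add: field_simps)
next
  case (Suc n)
  define x where "x = norm z"
  \<comment> \<open>The bound at \<open>z / 2\<close>: \<open>(x / 2) / (1 - x / 2)\<close>.\<close>
  define u where "u = x / (2 - x)"
  have x: "0 \<le> x" "x < 1" using Suc.prems by (auto simp: x_def)
  have u: "0 \<le> u" "u < 1" using x by (auto simp: u_def field_simps)
  define w where "w = poincare_approx n (z / 2)"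
  have "norm w \<le> norm (z / 2) / (1 - norm (z / 2))"
    unfolding w_def by (rule Suc.IH) (use x in \<open>simp add: norm_divide x_def\<close>)
  also have "\<dots> = u" using x by (simp add: u_def norm_divide x_def[symmetric] field_simps)
  finally have w: "norm w \<le> u" .
  have "norm (exp w - 1) \<le> exp (norm w) * norm w"
    using Taylor_exp_field[of w 0] by simp
  also have "\<dots> \<le> exp u * u" using w u by (intro mult_mono) auto
  also have "\<dots> \<le> 1 / (1 - u) * u"
    using exp_le_inverse_one_minus[OF u(2)] u by (intro mult_right_mono) auto
  also have "\<dots> = x / (1 - x) / 2"
  proof -
    have "1 - u = 2 * (1 - x) / (2 - x)" using x by (simp add: u_def field_simps)
    then show ?thesis using x by (simp add: u_def)
  qed
  finally have "2 * norm (exp w - 1) \<le> x / (1 - x)"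
    by (simp only: le_divide_eq_numeral1 mult.commute)
  moreover have "poincare_approx (Suc n) z = 2 * (exp w - 1)" by (simp add: w_def)
  ultimately show ?case by (simp only: norm_mult x_def[symmetric]) simp
qed

text \<open>
  The initial difference vanishes to second order at \<open>0\<close>, so halving the argument gains a factor
  \<open>1/4\<close>, whereas \<open>E\<close> expands by at most \<open>2 * exp (1/3) \<le> 3\<close> on the relevant disc. Differences
  of consecutive approximations therefore decay geometrically.
\<close>

lemma norm_poincare_approx_diff_le:
  assumes "norm z \<le> 1/2"
  shows "norm (poincare_approx (Suc n) z - poincare_approx n z) \<le> (3/4) ^ n * (norm z)\<^sup>2"
  using assms
proof (induction n arbitrary: z)
  case 0
  have "norm (exp (z/2) - (\<Sum>i\<le>1. (z/2) ^ i / fact i)) \<le> exp (norm (z/2)) * norm (z/2) ^ Suc 1 / fact 1"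
    by (rule Taylor_exp_field)
  then have "norm (exp (z/2) - 1 - z/2) \<le> exp (norm z / 2) * ((norm z)\<^sup>2 / 4)"
    by (simp add: norm_divide power_divide power2_eq_square algebra_simps)
  also have "\<dots> \<le> 2 * ((norm z)\<^sup>2 / 4)"
  proof (rule mult_right_mono)
    have "exp (norm z / 2) \<le> exp (1/4)" using 0 by simp
    also have "\<dots> \<le> 2" using exp_le_inverse_one_minus[of "1/4"] by simp
    finally show "exp (norm z / 2) \<le> 2" .
  qed auto
  finally have "norm (exp (z/2) - 1 - z/2) \<le> (norm z)\<^sup>2 / 2" by simp
  moreover have "poincare_approx (Suc 0) z - poincare_approx 0 z = 2 * (exp (z/2) - 1 - z/2)"
    by (simp add: algebra_simps)
  ultimately show ?case by (simp only: norm_mult) simp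
next
  case (Suc n)
  have B: "norm (poincare_approx m (z/2)) \<le> 1/3" for m
  proof -
    have "norm (poincare_approx m (z/2)) \<le> norm (z/2) / (1 - norm (z/2))"
      by (rule norm_poincare_approx_le) (use Suc.prems in \<open>simp add: norm_divide\<close>)
    also have "\<dots> \<le> 1/3" using Suc.prems by (simp add: norm_divide field_simps)
    finally show ?thesis .
  qed
  let ?a = "poincare_approx (Suc n) (z/2)" and ?b = "poincare_approx n (z/2)"
  have "poincare_approx (Suc m) z = 2 * (exp (poincare_approx m (z / 2)) - 1)" for m by simp
  then have "poincare_approx (Suc (Suc n)) z - poincare_approx (Suc n) z = 2 * (exp ?a - exp ?b)"
    by (simp only:) (simp only: algebra_simps)
  then have "norm (poincare_approx (Suc (Suc n)) z - poincare_approx (Suc n) z) = 2 * norm (exp ?a - exp ?b)"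
    by (simp only: norm_mult) simp
  also have "\<dots> \<le> 2 * (exp (1/3) * norm (?a - ?b))"
    by (intro mult_left_mono norm_exp_diff_le B) simp
  also have "\<dots> \<le> 2 * ((3/2) * ((3/4) ^ n * (norm (z/2))\<^sup>2))"
    using exp_le_inverse_one_minus[of "1/3"] Suc.prems
    by (intro mult_left_mono mult_mono Suc.IH) (auto simp: norm_divide)
  also have "\<dots> = (3/4) ^ Suc n * (norm z)\<^sup>2"
    by (simp add: norm_divide power_divide)
  finally show ?case .
qed

definition poincare :: "complex \<Rightarrow> complex" where
  "poincare z = lim (\<lambda>n. poincare_approx n z)"

lemma holomorphic_poincare_approx: "poincare_approx n holomorphic_on S"
proof (induction n arbitrary: S)
  case 0
  have "poincare_approx 0 = (\<lambda>z. z)" by auto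
  then show ?case by simp
next
  case (Suc n)
  have "(poincare_approx n \<circ> (\<lambda>z. z / 2)) holomorphic_on S"
    by (intro holomorphic_on_compose holomorphic_intros Suc) auto
  then have "(\<lambda>z. 2 * (exp (poincare_approx n (z / 2)) - 1)) holomorphic_on S"
    by (intro holomorphic_intros) (simp add: o_def)
  moreover have "poincare_approx (Suc n) = (\<lambda>z. 2 * (exp (poincare_approx n (z / 2)) - 1))" by auto
  ultimately show ?case by simp
qed

text \<open>
  The limit is \<open>z\<close> plus the telescoping series of differences, which is dominated by
  \<open>(\<Sum>n. (3/4) ^ n) = 4\<close> times \<open>(norm z)\<^sup>2\<close>.
\<close>

lemma poincare_near_0:
  shows "uniform_limit (cball 0 (1/2)) poincare_approx poincare sequentially"
    and "norm z \<le> 1/2 \<Longrightarrow> norm (poincare z - z) \<le> 4 * (norm z)\<^sup>2"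
proof -
  define D where "D n z = poincare_approx (Suc n) z - poincare_approx n z" for n z
  have sum_D: "(\<Sum>i<n. D i z) = poincare_approx n z - z" for n z
    using sum_lessThan_telescope[of "\<lambda>n. poincare_approx n z" n] by (simp add: D_def)
  have D: "norm (D n z) \<le> (3/4) ^ n * (norm z)\<^sup>2" if "norm z \<le> 1/2" for n z
    unfolding D_def by (rule norm_poincare_approx_diff_le[OF that])
  have geo: "(\<lambda>n. (3/4) ^ n * c) sums (4 * c)" for c :: real
    using sums_mult2[OF geometric_sums[of "3/4 :: real"], of c] by simp
  have "uniform_limit (cball 0 (1/2)) (\<lambda>n z. \<Sum>i<n. D i z) (\<lambda>z. \<Sum>i. D i z) sequentially"
  proof (rule Weierstrass_m_test)
    fix n and z :: complex assume "z \<in> cball 0 (1/2)"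
    then have z: "norm z \<le> 1/2" by simp
    have "(norm z)\<^sup>2 \<le> 1"  using z by (simp add: abs_square_le_1)
    then show "norm (D n z) \<le> (3/4) ^ n * 1"
      using D[OF z, of n] by (meson mult_left_mono order_trans zero_le_power zero_le_divide_iff zero_le_numeral)
  qed (use geo in \<open>blast intro: sums_summable\<close>)
  then have "uniform_limit (cball 0 (1/2)) (\<lambda>n z. z + (\<Sum>i<n. D i z)) (\<lambda>z. z + (\<Sum>i. D i z)) sequentially"
    by (intro uniform_limit_intros)
  then have lim: "uniform_limit (cball 0 (1/2)) poincare_approx (\<lambda>z. z + (\<Sum>i. D i z)) sequentially"
    by (simp add: sum_D)
  have eq: "poincare z = z + (\<Sum>i. D i z)" if "norm z \<le> 1/2" for z
    unfolding poincare_def using tendsto_uniform_limitI[OF lim, of z] that by (auto intro: limI)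
  show "uniform_limit (cball 0 (1/2)) poincare_approx poincare sequentially"
    using lim by (rule uniform_limit_cong'[THEN iffD1, rotated -1]) (auto simp: eq)
  show "norm (poincare z - z) \<le> 4 * (norm z)\<^sup>2" if z: "norm z \<le> 1/2"
  proof -
    have "norm (\<Sum>i. D i z) \<le> (\<Sum>i. (3/4) ^ i * (norm z)\<^sup>2)"
      by (rule norm_suminf_le) (use D[OF z] geo in \<open>auto intro: sums_summable\<close>)
    then show ?thesis using sums_unique[OF geo] by (simp add: eq[OF z])
  qed
qed

text \<open>
  Convergence spreads from the disc of radius \<open>1/2\<close> to the whole plane, since the recursion
  transports it from \<open>z / 2\<close> to \<open>z\<close>.
\<close>

lemma poincare_approx_tendsto: "(\<lambda>n. poincare_approx n z) \<longlonglongrightarrow> poincare z"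
proof -
  have "convergent (\<lambda>n. poincare_approx n z)" if "norm z \<le> 2 ^ k / 2" for k
    using that
  proof (induction k arbitrary: z)
    case 0
    then show ?case
      using tendsto_uniform_limitI[OF poincare_near_0(1), of z] by (auto simp: convergent_def)
  next
    case (Suc k)
    have "convergent (\<lambda>n. poincare_approx n (z/2))"
      by (rule Suc.IH) (use Suc.prems in \<open>simp add: norm_divide\<close>)
    then obtain l where "(\<lambda>n. poincare_approx n (z/2)) \<longlonglongrightarrow> l" by (auto simp: convergent_def)
    then have "(\<lambda>n. poincare_approx (Suc n) z) \<longlonglongrightarrow> 2 * (exp l - 1)"
      unfolding poincare_approx.simps by (intro tendsto_intros)
    then have "(\<lambda>n. poincare_approx n z) \<longlonglongrightarrow> 2 * (exp l - 1)" by (rule LIMSEQ_imp_Suc)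
    then show ?case by (rule convergentI)
  qed
  moreover obtain k where "norm z \<le> 2 ^ k / 2"
    using real_arch_pow[of 2 "2 * norm z"] by (auto simp: field_simps intro: less_imp_le)
  ultimately show ?thesis by (simp add: poincare_def convergent_LIMSEQ_iff)
qed

lemma poincare_functional_equation: "poincare z = 2 * (exp (poincare (z / 2)) - 1)"
proof (rule LIMSEQ_unique)
  show "(\<lambda>n. poincare_approx (Suc n) z) \<longlonglongrightarrow> poincare z"
    by (rule LIMSEQ_Suc[OF poincare_approx_tendsto])
  show "(\<lambda>n. poincare_approx (Suc n) z) \<longlonglongrightarrow> 2 * (exp (poincare (z / 2)) - 1)"
    unfolding poincare_approx.simps by (intro tendsto_intros poincare_approx_tendsto)
qed

text \<open>
  Holomorphy near \<open>0\<close> comes from uniform convergence; the functional equation then doubles the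
  radius of the disc on which it is known.
\<close>

lemma entire_poincare: "poincare \<in> entire"
proof -
  have hol: "poincare holomorphic_on ball 0 (2 ^ k / 2)" for k
  proof (induction k)
    case 0
    have "\<forall>n. continuous_on (cball 0 (1/2)) (poincare_approx n) \<and>
        poincare_approx n holomorphic_on ball 0 (1/2)"
      by (blast intro: holomorphic_poincare_approx holomorphic_on_imp_continuous_on)
    then have "poincare holomorphic_on ball 0 (1/2)"
      by (rule holomorphic_uniform_limit[OF always_eventually poincare_near_0(1)]) auto
    then show ?case by simp
  next
    case (Suc k)
    have "(poincare \<circ> (\<lambda>z. z / 2)) holomorphic_on ball 0 (2 ^ Suc k / 2)"
      by (rule holomorphic_on_compose_gen[OF _ Suc]) (auto intro!: holomorphic_intros simp: norm_divide)
    then have "(\<lambda>z. 2 * (exp (poincare (z / 2)) - 1)) holomorphic_on ball 0 (2 ^ Suc k / 2)"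
      by (intro holomorphic_intros) (simp add: o_def)
    then show ?case
      by (rule holomorphic_transform) (rule poincare_functional_equation[symmetric])
  qed
  have "poincare field_differentiable at z" for z
  proof -
    obtain k where "norm z < 2 ^ k / 2"
      using real_arch_pow[of 2 "2 * norm z"] by (auto simp: field_simps)
    then show ?thesis
      by (intro holomorphic_on_imp_differentiable_at[OF hol[of k]]) auto
  qed
  then show ?thesis by (simp add: entire_def holomorphic_on_def)
qed

section \<open>Infinite towers of exponentials\<close>

lemma zero_in_class_E: "(\<lambda>z. 0) \<in> class_E"
  unfolding class_E_def entire_def
  by (intro CollectI conjI exI[of _ "\<lambda>n z. 0"] exI[of _ "\<lambda>n. 0"]) simp_all

lemma class_E_subset_entire: "class_E \<subseteq> entire"
  unfolding class_E_def by blast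

lemma class_E_cases:
  assumes "f \<in> class_E"
  shows "f \<in> nonvanishing_entire \<or> f = (\<lambda>z. 0)"
proof -
  obtain F :: "nat \<Rightarrow> complex \<Rightarrow> complex" and c :: "nat \<Rightarrow> complex"
    where F: "F 0 = f" "\<And>n z. F n z = c (Suc n) * exp (F (Suc n) z)"
    using assms unfolding class_E_def by blast
  have "f = (\<lambda>z. c 1 * exp (F 1 z))" using F(1) F(2)[of 0] by (intro ext) simp
  moreover have "f \<in> entire" using assms class_E_subset_entire by blast
  ultimately show ?thesis
    by (cases "c 1 = 0") (auto simp: nonvanishing_entire_def)
qed

text \<open>Prepend one more level to the tower.\<close>

lemma mult_exp_in_class_E:
  assumes "f \<in> class_E"
  shows "(\<lambda>z. a * exp (f z)) \<in> class_E"
proof -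
  obtain F :: "nat \<Rightarrow> complex \<Rightarrow> complex" and c :: "nat \<Rightarrow> complex"
    where F: "F 0 = f" "\<And>n. n \<ge> 1 \<Longrightarrow> F n \<in> entire" "\<And>n z. F n z = c (Suc n) * exp (F (Suc n) z)"
      and f: "f \<in> entire"
    using assms unfolding class_E_def by blast
  have ent: "F n \<in> entire" for n using F(1,2) f by (cases n) auto
  let ?G = "\<lambda>n. case n of 0 \<Rightarrow> (\<lambda>z. a * exp (f z)) | Suc m \<Rightarrow> F m"
  \<comment> \<open>The shifted coefficients, with \<open>a\<close> in position \<open>1\<close>.\<close>
  let ?d = "\<lambda>n. if n = 1 then a else c (n - 1)"
  have "?G n z = ?d (Suc n) * exp (?G (Suc n) z)" for n z
    using F(1) F(3)[of "n - 1" z] by (cases n) auto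
  moreover have "?G n \<in> entire" if "n \<ge> 1" for n using ent that by (cases n) auto
  moreover have "(\<lambda>z. a * exp (f z)) \<in> entire"
    using f by (auto simp: entire_def intro!: holomorphic_intros)
  ultimately show ?thesis
    unfolding class_E_def by (intro CollectI conjI exI[of _ ?G] exI[of _ ?d] allI impI) simp_all
qed

text \<open>The constant is absorbed into the outermost coefficient.\<close>

lemma mult_in_class_E:
  assumes "f \<in> class_E"
  shows "(\<lambda>z. a * f z) \<in> class_E"
proof -
  obtain F :: "nat \<Rightarrow> complex \<Rightarrow> complex" and c :: "nat \<Rightarrow> complex"
    where F: "F 0 = f" "\<And>n. n \<ge> 1 \<Longrightarrow> F n \<in> entire" "\<And>n z. F n z = c (Suc n) * exp (F (Suc n) z)"
    using assms unfolding class_E_def by blast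
  have "F 1 \<in> class_E"
    unfolding class_E_def
    by (intro CollectI conjI exI[of _ "\<lambda>n. F (Suc n)"] exI[of _ "\<lambda>n. c (Suc n)"] allI impI F(3))
      (simp_all add: F(2))
  then have "(\<lambda>z. (a * c 1) * exp (F 1 z)) \<in> class_E" by (rule mult_exp_in_class_E)
  moreover have "f = (\<lambda>z. c 1 * exp (F 1 z))" using F(1) F(3)[of 0] by (intro ext) simp
  ultimately show ?thesis by (simp add: mult.assoc)
qed

text \<open>
  The additive constant \<open>2\<close> absorbs the \<open>-1\<close> in \<open>2 * (exp w - 1)\<close>; level \<open>n\<close> of the tower is
  \<open>2 + poincare (h z / 2 ^ n)\<close>.
\<close>

lemma two_plus_poincare_in_class_E:
  assumes "h \<in> entire"
  shows "(\<lambda>z. 2 + poincare (h z)) \<in> class_E"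
proof -
  let ?F = "\<lambda>n z. 2 + poincare (h z / 2 ^ n)"
  have ent: "?F n \<in> entire" for n
  proof -
    have "(poincare \<circ> (\<lambda>z. h z / 2 ^ n)) holomorphic_on UNIV"
      by (rule holomorphic_on_compose_gen[of _ _ poincare UNIV])
        (use assms entire_poincare in \<open>auto intro!: holomorphic_intros simp: entire_def\<close>)
    then show ?thesis unfolding entire_def o_def by (auto intro!: holomorphic_intros)
  qed
  have "?F n z = 2 * exp (-2) * exp (?F (Suc n) z)" for n z
  proof -
    have "exp (-2) * exp (?F (Suc n) z) = exp (poincare (h z / 2 ^ n / 2))"
      unfolding exp_add[symmetric] by (simp add: field_simps)
    then show ?thesis
      using poincare_functional_equation[of "h z / 2 ^ n"] by (simp add: algebra_simps)
  qed
  moreover have "(\<lambda>z. 2 + poincare (h z)) \<in> entire" using ent[of 0] by simp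
  ultimately show ?thesis
    unfolding class_E_def
    by (intro CollectI conjI exI[of _ ?F] exI[of _ "\<lambda>_. 2 * exp (-2)"] allI impI ent) simp_all
qed

text \<open>
  The translation by \<open>2\<close> is harmless below an outer exponential, where it only changes the
  coefficient. This leaves the rescaled Poincare function \<open>poincare (\<epsilon> * w) / \<epsilon>\<close>, which is close to
  \<open>w\<close> for small \<open>\<epsilon>\<close>.
\<close>

lemma exp_poincare_in_class_E:
  assumes "g \<in> entire" "\<epsilon> \<noteq> 0"
  shows "(\<lambda>z. exp (poincare (\<epsilon> * g z) / \<epsilon>)) \<in> class_E"
proof -
  have "(\<lambda>z. \<epsilon> * g z) \<in> entire" using assms by (auto simp: entire_def intro!: holomorphic_intros)
  then have "(\<lambda>z. 2 + poincare (\<epsilon> * g z)) \<in> class_E"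
    by (rule two_plus_poincare_in_class_E)
  then have "(\<lambda>z. 1 / \<epsilon> * (2 + poincare (\<epsilon> * g z))) \<in> class_E" by (rule mult_in_class_E)
  then have "(\<lambda>z. exp (- (2 / \<epsilon>)) * exp (1 / \<epsilon> * (2 + poincare (\<epsilon> * g z)))) \<in> class_E"
    by (rule mult_exp_in_class_E)
  moreover have "exp (- (2 / \<epsilon>)) * exp (1 / \<epsilon> * (2 + w)) = exp (w / \<epsilon>)" for w
    unfolding exp_add[symmetric] by (simp add: algebra_simps add_divide_distrib)
  ultimately show ?thesis by simp
qed

section \<open>The closure\<close>

lemma entire_imp_holomorphic_on: "f \<in> entire \<Longrightarrow> f holomorphic_on A"
  by (auto simp: entire_def intro: holomorphic_on_subset)

lemmas entire_imp_continuous_on = holomorphic_on_imp_continuous_on[OF entire_imp_holomorphic_on]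

text \<open>
  The point is that the set of entire functions that are \<open>e\<close>-close to \<open>f\<close> on the compact set \<open>K\<close> is
  open: on \<open>K\<close> the distance of a member \<open>g\<close> to \<open>f\<close> attains its maximum, which leaves room for a
  uniform perturbation.
\<close>

lemma in_closure_of_compact_open_entire_iff:
  assumes "S \<subseteq> entire"
  shows "f \<in> compact_open_entire closure_of S \<longleftrightarrow> f \<in> entire \<and>
    (\<forall>K e. compact K \<longrightarrow> e > 0 \<longrightarrow> (\<exists>g\<in>S. \<forall>z\<in>K. dist (g z) (f z) < e))" (is "?L \<longleftrightarrow> ?R")
proof
  assume R: ?R
  show ?L unfolding in_closure_of
  proof (intro conjI allI impI)
    fix T assume T: "f \<in> T \<and> openin compact_open_entire T"
    then obtain K e where "compact K" "e > 0" "{g \<in> entire. \<forall>z\<in>K. dist (g z) (f z) < e} \<subseteq> T"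
      unfolding openin_compact_open_entire_iff by blast
    moreover obtain g where "g \<in> S" "\<forall>z\<in>K. dist (g z) (f z) < e" using R calculation by blast
    ultimately show "\<exists>g. g \<in> S \<and> g \<in> T" using assms by blast
  qed (use R in simp)
next
  assume L: ?L
  then have f: "f \<in> entire" by (simp add: in_closure_of)
  have "\<exists>g\<in>S. \<forall>z\<in>K. dist (g z) (f z) < e" if K: "compact K" "e > 0" for K and e :: real
  proof -
    let ?T = "{g \<in> entire. \<forall>z\<in>K. dist (g z) (f z) < e}"
    have "\<exists>d>0. {h \<in> entire. \<forall>z\<in>K. dist (h z) (g z) < d} \<subseteq> ?T" if g: "g \<in> ?T" for g
    proof (cases "K = {}")
      case False
      have "continuous_on K (\<lambda>z. dist (g z) (f z))"
        using f g by (intro continuous_on_dist entire_imp_continuous_on) simp_all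
      then obtain w where w: "w \<in> K" "\<forall>z\<in>K. dist (g z) (f z) \<le> dist (g w) (f w)"
        using continuous_attains_sup[OF K(1) False] by blast
      show ?thesis
      proof (intro exI[of _ "e - dist (g w) (f w)"] conjI subsetI CollectI ballI)
        fix h z
        assume h: "h \<in> {h \<in> entire. \<forall>z\<in>K. dist (h z) (g z) < e - dist (g w) (f w)}" and z: "z \<in> K"
        then have "dist (h z) (g z) < e - dist (g w) (f w)" "dist (g z) (f z) \<le> dist (g w) (f w)"
          using w(2) by blast+
        then show "dist (h z) (f z) < e" using dist_triangle[of "h z" "f z" "g z"] by linarith
      qed (use g w in auto)
    next
      case True
      then show ?thesis by (intro exI[of _ 1]) simp
    qed
    then have "\<forall>g\<in>?T. \<exists>K d. compact K \<and> d > 0 \<and> {h \<in> entire. \<forall>z\<in>K. dist (h z) (g z) < d} \<subseteq> ?T"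
      using K(1) by meson
    then have "openin compact_open_entire ?T"
      by (subst openin_compact_open_entire_iff) simp
    moreover have "f \<in> ?T" using f K by simp
    ultimately have "\<exists>g. g \<in> S \<and> g \<in> ?T" using L[unfolded in_closure_of] by meson
    then show ?thesis by blast
  qed
  with f show ?R by blast
qed

text \<open>
  Hurwitz's theorem, by the minimum principle: around an isolated zero \<open>a\<close> of \<open>f\<close> there is a circle
  on which \<open>f\<close> is bounded away from \<open>0\<close>. A holomorphic function close to \<open>f\<close> is then smaller at
  \<open>a\<close> than on the circle, hence it has a zero inside.
\<close>

lemma closure_of_nonvanishing_or_zero:
  "compact_open_entire closure_of (nonvanishing_entire \<union> {\<lambda>z. 0}) \<subseteq> nonvanishing_entire \<union> {\<lambda>z. 0}"
proof (intro subsetI, rule ccontr)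
  fix f
  assume f: "f \<in> compact_open_entire closure_of (nonvanishing_entire \<union> {\<lambda>z. 0})"
    and not: "f \<notin> nonvanishing_entire \<union> {\<lambda>z. 0}"
  have "nonvanishing_entire \<union> {\<lambda>z. 0} \<subseteq> entire" by (auto simp: nonvanishing_entire_def entire_def)
  note closure = f[unfolded in_closure_of_compact_open_entire_iff[OF this]]
  then have ent: "f \<in> entire" by (rule conjunct1)
  obtain a where a: "f a = 0" using not ent by (auto simp: nonvanishing_entire_def)
  obtain w where w: "f w \<noteq> 0" using not by (auto simp: fun_eq_iff)
  obtain r where r: "r > 0" "\<And>z. z \<in> cball a r - {a} \<Longrightarrow> f z \<noteq> 0"
  proof -
    obtain r where r: "r > 0" "\<And>z. z \<in> ball a r - {a} \<Longrightarrow> f z \<noteq> 0"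
      by (rule isolated_zeros[OF entire_imp_holomorphic_on[OF ent, of UNIV] open_UNIV connected_UNIV
            UNIV_I a UNIV_I w]) (rule that)
    \<comment> \<open>Shrinking the disc keeps the bounding circle free of zeros.\<close>
    show thesis by (rule that[of "r/2"]) (use r in auto)
  qed
  obtain m where m: "m > 0" "\<And>z. z \<in> sphere a r \<Longrightarrow> m \<le> norm (f z)"
  proof -
    have "continuous_on (sphere a r) (\<lambda>z. norm (f z))"
      by (intro continuous_on_norm entire_imp_continuous_on ent)
    moreover have "sphere a r \<noteq> {}" using r by simp
    ultimately obtain u where "u \<in> sphere a r" "\<forall>z\<in>sphere a r. norm (f u) \<le> norm (f z)"
      using continuous_attains_inf[OF compact_sphere] by blast
    then show thesis using r by (intro that[of "norm (f u)"]) auto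
  qed
  have "\<exists>g\<in>nonvanishing_entire \<union> {\<lambda>z. 0}. \<forall>z\<in>cball a r. dist (g z) (f z) < m / 2"
    using conjunct2[OF closure, rule_format, OF compact_cball half_gt_zero[OF m(1)]] .
  then obtain g where g: "g \<in> nonvanishing_entire \<union> {\<lambda>z. 0}"
    and gf: "\<And>z. z \<in> cball a r \<Longrightarrow> dist (g z) (f z) < m / 2"
    by (elim bexE) simp
  have ga: "norm (g a) < m / 2" using gf[of a] a r by simp
  have gs: "norm (g z) > m / 2" if "z \<in> sphere a r" for z
  proof -
    have "norm (f z - g z) < m / 2" using gf[of z] that by (simp add: dist_norm norm_minus_commute)
    then show ?thesis using m(2)[OF that] norm_triangle_ineq2[of "f z" "g z"] by linarith
  qed
  have gh: "g holomorphic_on A" for A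
    using g by (auto simp: nonvanishing_entire_def entire_imp_holomorphic_on)
  obtain z where "z \<in> ball a r" "g z = 0"
  proof (rule holomorphic_contract_to_zero[OF holomorphic_on_imp_continuous_on[OF gh] gh r(1)])
    fix z assume "norm (a - z) = r"
    then have "z \<in> sphere a r" by (simp add: dist_norm)
    then show "norm (g a) < norm (g z)" using ga gs[of z] by linarith
  qed
  then have "g = (\<lambda>z. 0)" using g by (auto simp: nonvanishing_entire_def)
  moreover have "a + of_real r \<in> sphere a r" using r by (simp add: dist_norm)
  ultimately show False using gs[of "a + of_real r"] m(1) by simp
qed

text \<open>
  If \<open>M\<close> bounds \<open>g\<close> on \<open>K\<close>, then \<open>poincare (\<epsilon> * g z) / \<epsilon>\<close> differs from \<open>g z\<close> by at most
  \<open>4 * \<epsilon> * M\<^sup>2\<close>, and \<open>exp\<close> magnifies this by at most \<open>exp (M + 1)\<close> once the error is at most \<open>1\<close>.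
\<close>

lemma exp_approximable_by_class_E:
  assumes g: "g \<in> entire" and K: "compact K" and "e > 0"
  shows "\<exists>f\<in>class_E. \<forall>z\<in>K. dist (f z) (exp (g z)) < e"
proof -
  have "continuous_on K g" using g by (rule entire_imp_continuous_on)
  then have "bounded (g ` K)" using K compact_continuous_image compact_imp_bounded by blast
  then obtain M where M: "M > 0" "\<And>z. z \<in> K \<Longrightarrow> norm (g z) \<le> M"
    unfolding bounded_pos by blast
  define C where "C = exp (M + 1) * (4 * M\<^sup>2)"
  have C: "C > 0" using M by (simp add: C_def)
  \<comment> \<open>The three terms keep \<open>\<epsilon> * g z\<close> in the disc where \<open>poincare\<close> is controlled, the error in the
     exponent at most \<open>1\<close>, and the final error below \<open>e\<close>.\<close>
  define \<epsilon> where "\<epsilon> = min (1 / (2 * M)) (min (1 / (4 * M\<^sup>2)) (e / (2 * C)))"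
  have \<epsilon>: "\<epsilon> > 0" "\<epsilon> * M \<le> 1/2" "\<epsilon> * (4 * M\<^sup>2) \<le> 1" "\<epsilon> * C < e"
  proof -
    show "\<epsilon> > 0" using M C \<open>e > 0\<close> by (simp add: \<epsilon>_def)
    have "\<epsilon> \<le> 1 / (2 * M)" "\<epsilon> \<le> 1 / (4 * M\<^sup>2)" "\<epsilon> \<le> e / (2 * C)" by (auto simp: \<epsilon>_def)
    moreover have "2 * M > 0" "4 * M\<^sup>2 > 0" "2 * C > 0" using M(1) C by simp_all
    ultimately have "\<epsilon> * (2 * M) \<le> 1" "\<epsilon> * (4 * M\<^sup>2) \<le> 1" "\<epsilon> * (2 * C) \<le> e"
      by (simp_all only: pos_le_divide_eq)
    then show "\<epsilon> * M \<le> 1/2" "\<epsilon> * (4 * M\<^sup>2) \<le> 1" "\<epsilon> * C < e" using \<open>e > 0\<close> by linarith+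
  qed
  let ?f = "\<lambda>z. exp (poincare (of_real \<epsilon> * g z) / of_real \<epsilon>)"
  have "dist (?f z) (exp (g z)) < e" if z: "z \<in> K" for z
  proof -
    let ?w = "of_real \<epsilon> * g z"
    have w: "norm ?w \<le> \<epsilon> * M" using \<epsilon>(1) M(2)[OF z] by (simp add: norm_mult)
    have "norm (poincare ?w - ?w) \<le> 4 * (norm ?w)\<^sup>2"
      by (rule poincare_near_0(2)) (use w \<epsilon>(2) in linarith)
    also have "\<dots> \<le> 4 * (\<epsilon> * M)\<^sup>2"
      using w by (intro mult_left_mono power_mono) auto
    finally have sq: "norm (poincare ?w - ?w) \<le> 4 * (\<epsilon> * M)\<^sup>2" .
    have "poincare ?w / of_real \<epsilon> - g z = (poincare ?w - ?w) / of_real \<epsilon>"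
      using \<epsilon>(1) by (simp add: diff_divide_distrib)
    then have "norm (poincare ?w / of_real \<epsilon> - g z) = norm (poincare ?w - ?w) / \<epsilon>"
      using \<epsilon>(1) by (simp only: norm_divide norm_of_real abs_of_pos)
    also have "\<dots> \<le> 4 * (\<epsilon> * M)\<^sup>2 / \<epsilon>"
      using sq \<epsilon>(1) by (intro divide_right_mono) simp_all
    also have "\<dots> = \<epsilon> * (4 * M\<^sup>2)" using \<epsilon>(1) by (simp add: power2_eq_square)
    finally have close: "norm (poincare ?w / of_real \<epsilon> - g z) \<le> \<epsilon> * (4 * M\<^sup>2)" .
    have bound: "norm (poincare ?w / of_real \<epsilon>) \<le> M + 1"
      using close \<epsilon>(3) M(2)[OF z] norm_triangle_sub[of "poincare ?w / of_real \<epsilon>" "g z"]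
      by linarith
    have "norm (?f z - exp (g z)) \<le> exp (M + 1) * norm (poincare ?w / of_real \<epsilon> - g z)"
      by (rule norm_exp_diff_le[OF bound]) (use M(2)[OF z] in linarith)
    also have "\<dots> \<le> exp (M + 1) * (\<epsilon> * (4 * M\<^sup>2))" using close by (rule mult_left_mono) simp
    also have "\<dots> = \<epsilon> * C" unfolding C_def by (rule mult.left_commute)
    also have "\<dots> < e" by (rule \<epsilon>(4))
    finally show ?thesis by (simp only: dist_norm)
  qed
  then have "\<forall>z\<in>K. dist (?f z) (exp (g z)) < e" by (rule ballI)
  moreover have "?f \<in> class_E" by (rule exp_poincare_in_class_E[OF g]) (use \<epsilon>(1) in simp)
  ultimately show ?thesis by (rule bexI)
qed

theorem corollary9:
  shows "compact_open_entire closure_of class_E = nonvanishing_entire \<union> {\<lambda>z. 0}"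
proof (intro equalityI subsetI)
  fix f assume f: "f \<in> compact_open_entire closure_of class_E"
  have "class_E \<subseteq> nonvanishing_entire \<union> {\<lambda>z. 0}" using class_E_cases by blast
  from closure_of_mono[OF this] f
  have "f \<in> compact_open_entire closure_of (nonvanishing_entire \<union> {\<lambda>z. 0})" by (rule subsetD)
  with closure_of_nonvanishing_or_zero show "f \<in> nonvanishing_entire \<union> {\<lambda>z. 0}" by (rule subsetD)
next
  fix f assume "f \<in> nonvanishing_entire \<union> {\<lambda>z. 0}"
  then consider "f \<in> nonvanishing_entire" | "f = (\<lambda>z. 0)" by blast
  then show "f \<in> compact_open_entire closure_of class_E"
  proof cases
    case 1
    then have f: "f \<in> entire" "\<And>z. f z \<noteq> 0" by (auto simp: nonvanishing_entire_def)
    have "contractible (UNIV :: complex set)" by (intro convex_imp_contractible convex_UNIV)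
    then obtain g where g: "g holomorphic_on UNIV" "\<And>z. f z = exp (g z)"
      using contractible_imp_holomorphic_log[OF entire_imp_holomorphic_on[OF f(1)], of UNIV] f(2)
      by (metis UNIV_I)
    have "g \<in> entire" using g(1) by (simp add: entire_def)
    then have "\<exists>h\<in>class_E. \<forall>z\<in>K. dist (h z) (f z) < e" if "compact K" "e > 0" for K e
      unfolding g(2) using that by (rule exp_approximable_by_class_E)
    with f(1) show ?thesis
      by (subst in_closure_of_compact_open_entire_iff[OF class_E_subset_entire]) simp
  next
    case 2
    have "class_E \<subseteq> compact_open_entire closure_of class_E"
      using class_E_subset_entire by (intro closure_of_subset) simp
    with zero_in_class_E 2 show ?thesis by (simp add: subsetD)
  qed
qed

end
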